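(* Let $L$ be a multiset of integers greater than $2$ and let $m\ge 0$. If there is a graceful labeling $\Gamma$ of $[L,2\mid m]_\epsilon$ such that $\epsilon\in\Delta_p\Gamma$ (the path of $\Gamma$ contains an edge with difference $\epsilon$), then there is a $[\underline{2m+7},4,{}^2L]$-starter (over $\mathbb{Z}_{2n}$ for some $n$), i.e. a $2$-starter whose cycle through $\infty$ has length $2m+7$ and whose other cycles are one $4$-cycle and two $\ell$-cycles for each $\ell\in L$ (counted with multiplicity).
   Context: Notation: $\mathcal{I}(a,b)=\{x\in\mathbb{Z}\mid a\le x\le b\}$. For a multiset $L$ of integers $\ge 2$ and $m\ge 0$, $[L\mid m]$ is the vertex-disjoint union of one $\ell$-cycle for each $\ell\in L$ (with multiplicity; a $2$-cycle consists of two vertices joined by two parallel edges) and a path with $m$ edges; $[L,2\mid m]$ means $L$ with one extra $2$ added, and the subscript in $[L\mid m]_\epsilon$ denotes its number of edges $\epsilon=\sum_{\ell\in L}\ell+m$. A labeling of such a graph is an isomorphic copy whose vertices are distinct integers. For a graph $\Gamma$ with integer vertices, $\Delta\Gamma$ is the multiset of all differences $x-y$ over ordered pairs $(x,y)$ of adjacent vertices (each edge, including parallel ones, contributes both $\pm$ its difference), and $\Delta_p\Gamma$ is the corresponding multiset for the edges of the path component. A graceful labeling of $[L\mid m]_\epsilon$ (which contains at most one $2$-cycle) is a labeling $\Gamma$ with vertex set $\mathcal{I}(0,\epsilon)$ such that $\Delta\Gamma=\pm\mathcal{I}(1,\epsilon)$ if there is no $2$-cycle, and $\Delta\Gamma=\pm\{1,3,3\}\cup\pm\mathcal{I}(4,\epsilon)$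 (as multisets) if there is exactly one $2$-cycle. For graphs with vertices in $\mathbb{Z}_{2n}\cup\{\infty\}$, $\Delta$ is computed in $\mathbb{Z}_{2n}$ ignoring edges at $\infty$, and $\Sigma+n$ translates every vertex except $\infty$ by $n$. A $2$-starter over $\mathbb{Z}_{2n}$ is a $2$-regular graph $\Sigma$ with vertex set $\mathbb{Z}_{2n}\cup\{\infty\}$ such that $\Delta\Sigma\supseteq\mathbb{Z}_{2n}\setminus\{0\}$ and $\Sigma+n=\Sigma$. *)

theory Defs
  imports Complex_Main "HOL-Library.Multiset"
begin

text \<open>Undirected multigraphs: an edge is the set of its two ends, and parallel edges are
  repeated members of the multiset of edges.\<close>

record 'a multigraph =
  verts :: "'a set"
  edges :: "'a set multiset"

definition map_graph :: "('a \<Rightarrow> 'b) \<Rightarrow> 'a multigraph \<Rightarrow> 'b multigraph" where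
  "map_graph f G = \<lparr>verts = f ` verts G, edges = image_mset (image f) (edges G)\<rparr>"

definition graph_iso :: "('a \<Rightarrow> 'b) \<Rightarrow> 'a multigraph \<Rightarrow> 'b multigraph \<Rightarrow> bool" where
  "graph_iso f G H \<longleftrightarrow> inj_on f (verts G) \<and> H = map_graph f G"

definition disj_sum :: "'a multigraph \<Rightarrow> 'b multigraph \<Rightarrow> ('a + 'b) multigraph" where
  "disj_sum G H =
     \<lparr>verts = verts G <+> verts H,
      edges = image_mset (image Inl) (edges G) + image_mset (image Inr) (edges H)\<rparr>"

definition disj_Union :: "'i set \<Rightarrow> ('i \<Rightarrow> 'a multigraph) \<Rightarrow> ('i \<times> 'a) multigraph" where
  "disj_Union I G =
     \<lparr>verts = (SIGMA i:I. verts (G i)),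
      edges = (\<Sum>i\<in>I. image_mset (image (Pair i)) (edges (G i)))\<rparr>"

definition two_regular :: "'a multigraph \<Rightarrow> bool" where
  "two_regular G \<longleftrightarrow>
     (\<forall>e\<in>#edges G. e \<subseteq> verts G \<and> card e = 2) \<and>
     (\<forall>v\<in>verts G. size {#e \<in># edges G. v \<in> e#} = 2)"

text \<open>For \<open>l = 2\<close> the following is two vertices joined by two parallel edges.\<close>

definition cycle_graph :: "nat \<Rightarrow> nat multigraph" where
  "cycle_graph l =
     \<lparr>verts = {..<l}, edges = image_mset (\<lambda>i. {i, (i + 1) mod l}) (mset_set {..<l})\<rparr>"

definition path_graph :: "nat \<Rightarrow> nat multigraph" where
  "path_graph m =
     \<lparr>verts = {..m}, edges = image_mset (\<lambda>i. {i, i + 1}) (mset_set {..<m})\<rparr>"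

text \<open>The disjoint union of one \<open>l\<close>-cycle for each \<open>l\<close> in \<open>L\<close>, counted with multiplicity. The
  vertex \<open>((l, j), i)\<close> is the \<open>i\<close>-th vertex of the \<open>j\<close>-th \<open>l\<close>-cycle.\<close>

definition cycles_graph :: "nat multiset \<Rightarrow> ((nat \<times> nat) \<times> nat) multigraph" where
  "cycles_graph L =
     disj_Union (SIGMA l:set_mset L. {..<count L l}) (\<lambda>(l, j). cycle_graph l)"

type_synonym cp_vertex = "((nat \<times> nat) \<times> nat) + nat"

text \<open>The graph \<open>[L | m]\<close> and its number of edges.\<close>

definition cycles_path_graph :: "nat multiset \<Rightarrow> nat \<Rightarrow> cp_vertex multigraph" where
  "cycles_path_graph L m = disj_sum (cycles_graph L) (path_graph m)"

definition num_edges :: "nat multiset \<Rightarrow> nat \<Rightarrow> nat" where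
  "num_edges L m = sum_mset L + m"

text \<open>The ordered pairs of distinct elements of a set; for an edge, its two orientations.\<close>

definition ordered_pairs :: "'a set \<Rightarrow> ('a \<times> 'a) multiset" where
  "ordered_pairs e = mset_set {(x, y). x \<in> e \<and> y \<in> e \<and> x \<noteq> y}"

definition Delta :: "int multigraph \<Rightarrow> int multiset" where
  "Delta G = (\<Sum>e\<in>#edges G. image_mset (\<lambda>(x, y). x - y) (ordered_pairs e))"

text \<open>\<open>f\<close> exhibits \<open>Gamma\<close> as a copy of \<open>[L | m]\<close>; it carries the path component of \<open>[L | m]\<close>,
  whose vertices are tagged by \<open>Inr\<close>, to the path component of \<open>Gamma\<close>.\<close>

definition labeling ::
  "nat multiset \<Rightarrow> nat \<Rightarrow> (cp_vertex \<Rightarrow> int) \<Rightarrow> int multigraph \<Rightarrow> bool" where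
  "labeling L m f \<Gamma> \<longleftrightarrow> graph_iso f (cycles_path_graph L m) \<Gamma>"

definition path_component :: "nat \<Rightarrow> (cp_vertex \<Rightarrow> int) \<Rightarrow> int multigraph" where
  "path_component m f = map_graph (\<lambda>i. f (Inr i)) (path_graph m)"

definition plus_minus :: "int multiset \<Rightarrow> int multiset" where
  "plus_minus M = M + image_mset uminus M"

definition graceful_labeling ::
  "nat multiset \<Rightarrow> nat \<Rightarrow> (cp_vertex \<Rightarrow> int) \<Rightarrow> int multigraph \<Rightarrow> bool" where
  "graceful_labeling L m f \<Gamma> \<longleftrightarrow>
     labeling L m f \<Gamma> \<and>
     count L 2 \<le> 1 \<and>
     verts \<Gamma> = {0..int (num_edges L m)} \<and>
     Delta \<Gamma> =
       (if count L 2 = 0 then plus_minus (mset_set {1..int (num_edges L m)})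
        else plus_minus {#1, 3, 3#} + plus_minus (mset_set {4..int (num_edges L m)}))"

text \<open>The set \<open>\<int>\<^sub>2\<^sub>n \<union> {\<infinity>}\<close> consists of \<open>None\<close>, standing for \<open>\<infinity>\<close>, and of \<open>Some x\<close> for the
  representatives \<open>0 \<le> x < 2 n\<close>.\<close>

definition starter_points :: "nat \<Rightarrow> int option set" where
  "starter_points n = insert None (Some ` {0..<2 * int n})"

definition Delta_mod :: "nat \<Rightarrow> int option multigraph \<Rightarrow> int multiset" where
  "Delta_mod n G =
     (\<Sum>e\<in>#edges G. image_mset (\<lambda>(x, y). (x - y) mod (2 * int n)) (ordered_pairs (Some -` e)))"

definition translate :: "nat \<Rightarrow> int \<Rightarrow> int option multigraph \<Rightarrow> int option multigraph" where
  "translate n t G = map_graph (map_option (\<lambda>x. (x + t) mod (2 * int n))) G"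

definition two_starter :: "nat \<Rightarrow> int option multigraph \<Rightarrow> bool" where
  "two_starter n \<Sigma> \<longleftrightarrow>
     n > 0 \<and>
     two_regular \<Sigma> \<and>
     verts \<Sigma> = starter_points n \<and>
     {1..<2 * int n} \<subseteq> set_mset (Delta_mod n \<Sigma>) \<and>
     translate n (int n) \<Sigma> = \<Sigma>"

text \<open>A 2-starter whose cycle through \<open>\<infinity>\<close> has length \<open>k\<close> and whose other cycles have the
  lengths listed in \<open>K\<close>.\<close>

definition cycle_type_starter ::
  "nat \<Rightarrow> nat multiset \<Rightarrow> nat \<Rightarrow> int option multigraph \<Rightarrow> bool" where
  "cycle_type_starter k K n \<Sigma> \<longleftrightarrow>
     two_starter n \<Sigma> \<and>
     (\<exists>g. graph_iso g (disj_sum (cycles_graph K) (cycle_graph k)) \<Sigma> \<and>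
          None \<in> g ` Inr ` verts (cycle_graph k))"

end

theory Submission
  imports Defs
begin

text \<open>Put \<open>n = \<epsilon> + 3\<close> and write \<open>x'\<close> for \<open>x + n\<close> in \<open>\<int>\<^sub>2\<^sub>n\<close>. The 2-cycle of \<open>\<Gamma>\<close> is \<open>{a, b}\<close> with
  \<open>\<bar>a - b\<bar> = 3\<close>; the 2-cycles of \<open>\<Gamma>\<close> and \<open>\<Gamma> + n\<close> are replaced by the 4-cycle \<open>(a, b, a', b')\<close>, whose
  differences are 3 and \<open>\<epsilon>\<close>. Hence the edge \<open>{0, \<epsilon>}\<close> of the path \<open>p\<^sub>0, \<dots>, p\<^sub>m\<close>, say \<open>p\<^sub>k = 0\<close> and
  \<open>p\<^sub>k\<^sub>+\<^sub>1 = \<epsilon>\<close>, can be removed. The differences 2, \<open>\<epsilon> + 1\<close>, \<open>\<epsilon> + 2\<close>, \<open>n\<close> still missing and the points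
  \<open>\<epsilon> + 1\<close>, \<open>\<epsilon> + 2\<close> with their translates are supplied by the cycle of length \<open>2m + 7\<close> that runs from
  \<open>\<infinity>\<close> through \<open>p\<^sub>0, \<dots>, p\<^sub>k, \<epsilon> + 1, (\<epsilon> + 2)', p\<^sub>k\<^sub>+\<^sub>1', \<dots>, p\<^sub>m'\<close> and returns to \<open>\<infinity>\<close> through the translates
  of these points in reverse order.\<close>

section \<open>Unions of cycles as graphs of a successor map\<close>

lemma mset_set_Sigma:
  assumes "finite I" and "\<And>i. i \<in> I \<Longrightarrow> finite (A i)"
  shows "mset_set (Sigma I A) = (\<Sum>i\<in>I. image_mset (Pair i) (mset_set (A i)))"
  using assms
proof (induction I rule: finite_induct)
  case (insert x I)
  have "Sigma (insert x I) A = Pair x ` A x \<union> Sigma I A" by auto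
  moreover have "mset_set (Pair x ` A x \<union> Sigma I A) = mset_set (Pair x ` A x) + mset_set (Sigma I A)"
    using insert by (intro mset_set_Union) auto
  ultimately show ?case
    using insert by (simp add: image_mset_mset_set inj_on_def)
qed simp

fun cycle_succ :: "(nat \<times> nat) \<times> nat \<Rightarrow> (nat \<times> nat) \<times> nat" where
  "cycle_succ ((l, j), i) = ((l, j), (i + 1) mod l)"

lemma mem_verts_cycles_graph [simp]:
  "((l, j), i) \<in> verts (cycles_graph K) \<longleftrightarrow> j < count K l \<and> i < l"
  by (auto simp: cycles_graph_def disj_Union_def cycle_graph_def count_greater_zero_iff[symmetric]
      simp del: count_greater_zero_iff)

lemma verts_cycles_graph:
  "verts (cycles_graph K) = (SIGMA (l, j):(SIGMA l:set_mset K. {..<count K l}). {..<l})"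
  by (simp add: cycles_graph_def disj_Union_def cycle_graph_def case_prod_unfold)

lemma finite_verts_cycles_graph [simp]: "finite (verts (cycles_graph K))"
  unfolding verts_cycles_graph by (intro finite_SigmaI) auto

text \<open>\<open>A\<close> may exceed \<open>set_mset K\<close>, so that it stays fixed while the
  induction adds elements to \<open>K\<close>.\<close>

lemma sum_count_mult:
  assumes "finite A" and "set_mset K \<subseteq> A"
  shows "(\<Sum>l\<in>A. count K l * l) = sum_mset K"
  using assms(2)
proof (induction K)
  case (add x K)
  have "(\<Sum>l\<in>A. count (add_mset x K) l * l) = (\<Sum>l\<in>A. count K l * l + (if l = x then l else 0))"
    by (intro sum.cong) auto
  then show ?case
    using add assms(1) by (simp add: sum.distrib)
qed simp

lemma card_verts_cycles_graph: "card (verts (cycles_graph K)) = sum_mset K"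
proof -
  have "card (verts (cycles_graph K)) = (\<Sum>(l, j)\<in>(SIGMA l:set_mset K. {..<count K l}). l)"
    unfolding verts_cycles_graph by (subst card_SigmaI) (auto intro!: sum.cong)
  also have "\<dots> = (\<Sum>l\<in>set_mset K. count K l * l)"
    by (subst sum.Sigma[symmetric]) auto
  also have "\<dots> = sum_mset K"
    by (rule sum_count_mult) auto
  finally show ?thesis .
qed

text \<open>Each edge is indexed by the vertex it leaves, so one image of the vertex set lists all
  edges with multiplicity. Regularity and invariance under translation thereby become statements
  about maps on vertices.\<close>

lemma edges_cycles_graph:
  "edges (cycles_graph K) = image_mset (\<lambda>v. {v, cycle_succ v}) (mset_set (verts (cycles_graph K)))"
proof -
  let ?I = "SIGMA l:set_mset K. {..<count K l}"
  have "mset_set (verts (cycles_graph K)) =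
      (\<Sum>x\<in>?I. image_mset (Pair x) (mset_set {..<fst x}))"
    unfolding verts_cycles_graph case_prod_unfold by (rule mset_set_Sigma) auto
  moreover have "image_mset f (sum g A) = (\<Sum>x\<in>A. image_mset f (g x))"
    if "finite A" for f :: "(nat \<times> nat) \<times> nat \<Rightarrow> ((nat \<times> nat) \<times> nat) set" and g and A :: "(nat \<times> nat) set"
    using that by (induction A rule: finite_induct) auto
  ultimately show ?thesis
    by (auto simp: cycles_graph_def disj_Union_def cycle_graph_def multiset.map_comp comp_def
        intro!: sum.cong image_mset_cong)
qed

abbreviation cycles_with :: "nat \<Rightarrow> nat multiset \<Rightarrow> cp_vertex multigraph" where
  "cycles_with k K \<equiv> disj_sum (cycles_graph K) (cycle_graph k)"

fun cycles_with_succ :: "nat \<Rightarrow> cp_vertex \<Rightarrow> cp_vertex" where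
  "cycles_with_succ k (Inl v) = Inl (cycle_succ v)"
| "cycles_with_succ k (Inr i) = Inr ((i + 1) mod k)"

lemma verts_cycles_with: "verts (cycles_with k K) = verts (cycles_graph K) <+> {..<k}"
  by (simp add: disj_sum_def cycle_graph_def)

lemma mset_set_Plus:
  assumes "finite A" "finite B"
  shows "mset_set (A <+> B) = image_mset Inl (mset_set A) + image_mset Inr (mset_set B)"
  unfolding Plus_def using assms
  by (subst mset_set_Union) (auto simp: image_mset_mset_set)

lemma edges_cycles_with:
  "edges (cycles_with k K) =
     image_mset (\<lambda>v. {v, cycles_with_succ k v}) (mset_set (verts (cycles_with k K)))"
  by (simp add: verts_cycles_with mset_set_Plus)
    (simp add: disj_sum_def cycle_graph_def edges_cycles_graph multiset.map_comp comp_def)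

section \<open>Two-regularity\<close>

lemma two_regular_permutation:
  assumes fin: "finite (verts G)" and E: "edges G = image_mset (\<lambda>v. {v, s v}) (mset_set (verts G))"
    and bij: "bij_betw s (verts G) (verts G)" and nofix: "\<And>v. v \<in> verts G \<Longrightarrow> s v \<noteq> v"
  shows "two_regular G"
  unfolding two_regular_def
proof (intro conjI ballI)
  fix e assume "e \<in># edges G"
  then obtain v where v: "v \<in> verts G" "e = {v, s v}" using fin E by auto
  moreover have "s v \<in> verts G" using v bij by (auto simp: bij_betw_def)
  ultimately show "e \<subseteq> verts G" by simp
  show "card e = 2" unfolding v(2) using nofix[OF v(1)] by (subst card_2_iff) metis
next
  fix w assume w: "w \<in> verts G"
  from w bij obtain u where u: "u \<in> verts G" "s u = w"
    by (metis bij_betw_imp_surj_on imageE)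
  \<comment> \<open>The edges at \<open>w\<close> are the one leaving \<open>w\<close> and the one
    leaving its predecessor \<open>u\<close>. Counting indices instead of edges keeps the two
    parallel edges of a 2-cycle apart.\<close>
  have "{v \<in> verts G. w \<in> {v, s v}} = {w, u}"
    using u w bij_betw_imp_inj_on[OF bij] by (auto dest: inj_onD)
  moreover have "u \<noteq> w" using nofix[OF u(1)] u(2) by metis
  ultimately have "card {v \<in> verts G. w \<in> {v, s v}} = 2" by simp
  moreover have "size {#e \<in># edges G. w \<in> e#} = card {v \<in> verts G. w \<in> {v, s v}}"
    using fin by (simp add: E filter_mset_image_mset filter_mset_mset_set)
  ultimately show "size {#e \<in># edges G. w \<in> e#} = 2" by simp
qed

lemma two_regular_map_graph:
  assumes G: "two_regular G" and inj: "inj_on f (verts G)"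
  shows "two_regular (map_graph f G)"
proof -
  have sub: "e \<subseteq> verts G" and card: "card e = 2" if "e \<in># edges G" for e
    using G that by (simp_all add: two_regular_def)
  have deg: "size {#e \<in># edges G. f v \<in> f ` e#} = 2" if v: "v \<in> verts G" for v
  proof -
    have "{#e \<in># edges G. f v \<in> f ` e#} = {#e \<in># edges G. v \<in> e#}"
      using inj_on_image_mem_iff[OF inj v sub] by (intro filter_mset_cong) simp_all
    then show ?thesis
      using G v by (simp add: two_regular_def)
  qed
  have "f ` e \<subseteq> f ` verts G" "card (f ` e) = 2" if "e \<in># edges G" for e
    using sub[OF that] card[OF that] inj_on_subset[OF inj sub[OF that]]
    by (simp_all add: card_image image_mono)
  then show ?thesis
    unfolding two_regular_def map_graph_def
    using deg by (simp add: filter_mset_image_mset)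
qed

lemma inj_on_Suc_mod: "inj_on (\<lambda>i. (i + 1) mod l) {..<l}" for l :: nat
proof (rule inj_onI)
  fix i j :: nat assume "i \<in> {..<l}" "j \<in> {..<l}" "(i + 1) mod l = (j + 1) mod l"
  then show "i = j" by (cases "i + 1 = l"; cases "j + 1 = l") auto
qed

lemma two_regular_cycles_with:
  assumes "k \<ge> 2" and "\<forall>l\<in>#K. l \<ge> 2"
  shows "two_regular (cycles_with k K)"
proof (rule two_regular_permutation[OF _ edges_cycles_with])
  let ?V = "verts (cycles_with k K)"
  show fin: "finite ?V" by (simp add: verts_cycles_with)
  have nofix: "(i + 1) mod l \<noteq> i" if "l \<ge> 2" "i < l" for i l :: nat
    using that by (cases "i + 1 = l") auto
  have l: "l \<ge> 2" if "j < count K l" for l j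
    using assms(2) that by (metis count_eq_zero_iff less_nat_zero_code)
  show "cycles_with_succ k v \<noteq> v" if "v \<in> ?V" for v
    using that nofix l assms(1) by (cases v) (auto simp: verts_cycles_with)
  have "inj_on (cycles_with_succ k) ?V"
    using inj_on_Suc_mod by (auto simp: inj_on_def verts_cycles_with)
  moreover have "cycles_with_succ k ` ?V \<subseteq> ?V"
    using assms(1) by (auto simp: verts_cycles_with dest: l)
  ultimately show "bij_betw (cycles_with_succ k) ?V ?V"
    using fin by (simp add: bij_betw_def endo_inj_surj)
qed

section \<open>Differences, and the data of the construction\<close>

lemma in_ordered_pairs:
  assumes "finite e"
  shows "(x, y) \<in># ordered_pairs e \<longleftrightarrow> x \<in> e \<and> y \<in> e \<and> x \<noteq> y"
proof -
  have "finite {(x, y). x \<in> e \<and> y \<in> e \<and> x \<noteq> y}"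
    by (rule finite_subset[of _ "e \<times> e"]) (use assms in auto)
  then show ?thesis
    by (simp add: ordered_pairs_def)
qed

lemma in_Delta_modI:
  assumes "e \<in># edges G" "finite e" "Some x \<in> e" "Some y \<in> e" "x \<noteq> y"
  shows "(x - y) mod (2 * int n) \<in># Delta_mod n G"
proof -
  have "finite (Some -` e)"
    using assms(2) by (intro finite_vimageI) auto
  then have "(x, y) \<in># ordered_pairs (Some -` e)"
    using assms by (simp add: in_ordered_pairs)
  then show ?thesis
    using assms(1) unfolding Delta_mod_def by (force simp: in_Union_mset_iff)
qed

text \<open>What the construction takes from a graceful labeling, with \<epsilon> written as
  \<open>int n - 3\<close>: \<open>F\<close> labels the cycles of \<open>L\<close>, \<open>a\<close>
  and \<open>b\<close> are the ends of the 2-cycle, \<open>p\<close> runs along the path and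
  \<open>k\<close> is the place of its edge of difference \<epsilon>. The labels are required to
  fill the interval; injectivity of the final labeling then comes from counting. The differences 3
  and \<epsilon> are absent from \<open>diffs\<close> because the 4-cycle supplies them.\<close>

locale starter_labels =
  fixes L :: "nat multiset" and m k :: nat
    and F :: "(nat \<times> nat) \<times> nat \<Rightarrow> int" and a b :: int and p :: "nat \<Rightarrow> int"
    and n :: nat
  defines "n \<equiv> sum_mset L + m + 5"
  assumes L: "\<And>l. l \<in># L \<Longrightarrow> 2 < l"
    and labels: "F ` verts (cycles_graph L) \<union> {a, b} \<union> p ` {..m} = {0..int n - 3}"
    and k: "k < m" "p k = 0" "p (Suc k) = int n - 3"
    and ab: "\<bar>a - b\<bar> = 3"
    and diffs: "\<And>d. d = 1 \<or> 4 \<le> d \<and> d < int n - 3 \<Longrightarrow>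
      (\<exists>v\<in>verts (cycles_graph L). \<bar>F v - F (cycle_succ v)\<bar> = d) \<or>
      (\<exists>i<m. \<bar>p i - p (Suc i)\<bar> = d)"
begin

section \<open>The labels of the starter\<close>

abbreviation cycle_lengths :: "nat multiset" where
  "cycle_lengths \<equiv> add_mset 4 (L + L)"

abbreviation skeleton :: "cp_vertex multigraph" where
  "skeleton \<equiv> cycles_with (2 * m + 7) cycle_lengths"

abbreviation shift :: "int option \<Rightarrow> int option" where
  "shift \<equiv> map_option (\<lambda>x. (x + int n) mod (2 * int n))"

text \<open>For each length \<open>l\<close> the first \<open>count L l\<close> cycles are those of
  the given labeling and the next \<open>count L l\<close> are their translates. An index
  \<open>j\<close> beyond these exists only for \<open>l = 4\<close> and belongs to the 4-cycle that
  replaces the 2-cycles.\<close>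

fun cycle_label :: "(nat \<times> nat) \<times> nat \<Rightarrow> int" where
  "cycle_label ((l, j), i) =
     (if j < count L l then F ((l, j), i)
      else if j < 2 * count L l then F ((l, j - count L l), i) + int n
      else [a, b, a + int n, b + int n] ! i)"

text \<open>Positions 1 to \<open>m + 3\<close> of the long cycle, with the path cut at its edge
  \<open>k\<close>: a point \<open>p i\<close> sits at position \<open>i + 1\<close> before the cut
  and, translated, at \<open>i + 3\<close> after it. The two points inserted at the cut are
  \<epsilon> + 1 and the translate of \<epsilon> + 2.\<close>

definition half_label :: "nat \<Rightarrow> int" where
  "half_label t =
     (if t \<le> k + 1 then p (t - 1) else if t = k + 2 then int n - 2
      else if t = k + 3 then 2 * int n - 1 else p (t - 3) + int n)"

definition long_label :: "nat \<Rightarrow> int option" where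
  "long_label t =
     (if t = 0 then None else if t \<le> m + 3 then Some (half_label t)
      else shift (Some (half_label (2 * m + 7 - t))))"

definition label :: "cp_vertex \<Rightarrow> int option" where
  "label = case_sum (Some \<circ> cycle_label) long_label"

text \<open>Translation by \<open>n\<close> maps the edge at \<open>v\<close> to the edge at \<open>twin v\<close>; it reverses the long cycle.\<close>

fun twin :: "cp_vertex \<Rightarrow> cp_vertex" where
  "twin (Inl ((l, j), i)) =
     (if j < count L l then Inl ((l, j + count L l), i)
      else if j < 2 * count L l then Inl ((l, j - count L l), i)
      else Inl ((l, j), (i + 2) mod 4))"
| "twin (Inr t) = Inr (2 * m + 6 - t)"

lemma n_pos: "5 \<le> int n"
proof -
  have "5 \<le> n" by (simp add: n_def)
  then show ?thesis by simp
qed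

lemma F_range: "v \<in> verts (cycles_graph L) \<Longrightarrow> 0 \<le> F v \<and> F v \<le> int n - 3"
  and ab_range: "0 \<le> a" "a \<le> int n - 3" "0 \<le> b" "b \<le> int n - 3"
  and p_range: "i \<le> m \<Longrightarrow> 0 \<le> p i \<and> p i \<le> int n - 3"
proof -
  show "0 \<le> F v \<and> F v \<le> int n - 3" if "v \<in> verts (cycles_graph L)"
  proof -
    have "F v \<in> {0..int n - 3}" unfolding labels[symmetric] using that by blast
    then show ?thesis by simp
  qed
  have "a \<in> {0..int n - 3}" "b \<in> {0..int n - 3}" unfolding labels[symmetric] by blast+
  then show "0 \<le> a" "a \<le> int n - 3" "0 \<le> b" "b \<le> int n - 3" by simp_all
  show "0 \<le> p i \<and> p i \<le> int n - 3" if "i \<le> m"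
  proof -
    have "p i \<in> {0..int n - 3}" unfolding labels[symmetric] using that by blast
    then show ?thesis by simp
  qed
qed

lemma half_label_range:
  assumes "1 \<le> t" "t \<le> m + 3"
  shows "0 \<le> half_label t \<and> half_label t < 2 * int n"
proof -
  have "t \<le> k + 1 \<Longrightarrow> 0 \<le> p (t - 1) \<and> p (t - 1) \<le> int n - 3"
    using k by (intro p_range) simp
  moreover have "0 \<le> p (t - 3) \<and> p (t - 3) \<le> int n - 3"
    using assms by (intro p_range) simp
  ultimately show ?thesis
    using n_pos by (auto simp: half_label_def)
qed

lemma shift_mod_twice: "0 \<le> x \<Longrightarrow> x < 2 * int n \<Longrightarrow> ((x + int n) mod (2 * int n) + int n) mod (2 * int n) = x"
  by (simp add: mod_simps algebra_simps)

lemma long_label_mirror: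
  assumes "1 \<le> t" "t \<le> 2 * m + 6"
  shows "long_label (2 * m + 7 - t) = shift (long_label t)"
  using assms half_label_range[of "2 * m + 7 - t"] n_pos
  by (auto simp: long_label_def shift_mod_twice)

text \<open>Translation preserves the direction of the cycles avoiding infinity, so on them
  \<open>twin\<close> acts on vertices and commutes with the successor. It swaps the two copies of
  each cycle of \<open>L\<close> and turns the 4-cycle by two positions.\<close>

lemma shift_cycle_label_twin:
  assumes "v \<in> verts (cycles_graph cycle_lengths)"
  shows "\<exists>w. twin (Inl v) = Inl w \<and> w \<in> verts (cycles_graph cycle_lengths) \<and>
    twin (Inl (cycle_succ v)) = Inl (cycle_succ w) \<and> twin (Inl w) = Inl v \<and>
    cycle_label w = (cycle_label v + int n) mod (2 * int n)"
proof -
  obtain l j i where v: "v = ((l, j), i)" by (metis surj_pair)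
  have ji: "j < count cycle_lengths l" "i < l" using assms v by auto
  have small: "(x + int n) mod (2 * int n) = x + int n" "(x + int n + int n) mod (2 * int n) = x"
    if "0 \<le> x" "x \<le> int n - 3" for x
    using that shift_mod_twice[of x] n_pos by simp_all
  consider "j < count L l" | "count L l \<le> j" "j < 2 * count L l"
    | "j = 2 * count L 4" "l = 4" using ji by (force split: if_splits)
  then show ?thesis
  proof cases
    case 1
    then have "(F v + int n) mod (2 * int n) = F v + int n"
      using F_range[of v] v ji by (intro small) simp_all
    then show ?thesis
      using 1 v ji by (intro exI[of _ "((l, j + count L l), i)"]) auto
  next
    case 2
    let ?w = "((l, j - count L l), i)"
    have "(F ?w + int n + int n) mod (2 * int n) = F ?w"
      using F_range[of ?w] 2 ji by (intro small) auto
    then show ?thesis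
      using 2 v ji by (intro exI[of _ ?w]) auto
  next
    case 3
    then have "i = 0 \<or> i = 1 \<or> i = 2 \<or> i = 3" using ji by auto
    then show ?thesis
      using 3 v ab_range small[of a] small[of b]
      by (intro exI[of _ "((4, 2 * count L 4), (i + 2) mod 4)"]) (elim disjE; simp)
  qed
qed

section \<open>Translation symmetry and bijectivity of the labels\<close>

lemma Inl_in_skeleton: "v \<in> verts (cycles_graph cycle_lengths) \<Longrightarrow> Inl v \<in> verts skeleton"
  by (simp add: verts_cycles_with InlI)

lemma card_skeleton: "card (verts skeleton) = 2 * n + 1"
  by (simp add: verts_cycles_with card_Plus card_verts_cycles_graph n_def)

lemma finite_skeleton: "finite (verts skeleton)"
  by (simp add: verts_cycles_with)

lemma card_starter_points: "card (starter_points n) = 2 * n + 1"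
  unfolding starter_points_def by (subst card_insert_disjoint) (auto simp: card_image)

lemma Inr_in_skeleton: "t \<le> 2 * m + 6 \<Longrightarrow> Inr t \<in> verts skeleton"
  by (auto simp: verts_cycles_with)

lemma label_simps [simp]:
  "label (Inl v) = Some (cycle_label v)" "label (Inr t) = long_label t"
  by (simp_all add: label_def)

text \<open>The first three claims yield invariance of the edge multiset, the last one closure of
  the set of labels under translation.\<close>

lemma twin:
  assumes "v \<in> verts skeleton"
  shows "twin v \<in> verts skeleton" "twin (twin v) = v"
    "shift ` {label v, label (cycles_with_succ (2 * m + 7) v)} =
       {label (twin v), label (cycles_with_succ (2 * m + 7) (twin v))}"
    "\<exists>w\<in>verts skeleton. label w = shift (label v)"
proof -
  have "twin v \<in> verts skeleton \<and> twin (twin v) = v \<and>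
    shift ` {label v, label (cycles_with_succ (2 * m + 7) v)} =
       {label (twin v), label (cycles_with_succ (2 * m + 7) (twin v))} \<and>
    (\<exists>w\<in>verts skeleton. label w = shift (label v))"
  proof (cases v)
    case (Inl u)
    then have u: "u \<in> verts (cycles_graph cycle_lengths)" using assms by (auto simp: verts_cycles_with)
    obtain w where w: "twin (Inl u) = Inl w" "w \<in> verts (cycles_graph cycle_lengths)"
      "twin (Inl (cycle_succ u)) = Inl (cycle_succ w)" "twin (Inl w) = Inl u"
      "cycle_label w = (cycle_label u + int n) mod (2 * int n)"
      using shift_cycle_label_twin[OF u] by blast
    obtain l j i where uu: "u = ((l, j), i)" by (metis surj_pair)
    have "cycle_succ u \<in> verts (cycles_graph cycle_lengths)" using u uu by simp
    from shift_cycle_label_twin[OF this] w(3)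
    have "cycle_label (cycle_succ w) = (cycle_label (cycle_succ u) + int n) mod (2 * int n)" by auto
    moreover have "\<exists>w\<in>verts skeleton. label w = shift (label v)"
      using w(2,5) Inl by (intro bexI[of _ "Inl w"] Inl_in_skeleton) simp_all
    ultimately show ?thesis using w Inl by (simp add: Inl_in_skeleton)
  next
    case (Inr t)
    then have t: "t \<le> 2 * m + 6" using assms by (auto simp: verts_cycles_with)
    \<comment> \<open>On the long cycle, translation fixes position 0 and swaps \<open>t\<close>
      with \<open>2 * m + 7 - t\<close>. The edge from \<open>t\<close> to \<open>t + 1\<close> thus
      goes to the edge leaving \<open>2 * m + 6 - t\<close>, with its ends interchanged;
      \<open>A\<close> and \<open>B\<close> follow the two ends, and the reduction modulo
      \<open>2 * m + 7\<close> matters only where an end is position 0.\<close>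
    have A: "long_label ((2 * m + 6 - t + 1) mod (2 * m + 7)) = shift (long_label t)"
    proof (cases "t = 0")
      case False
      then have "2 * m + 6 - t + 1 = 2 * m + 7 - t" using t by simp
      then show ?thesis using long_label_mirror[of t] t False by simp
    next
      case True
      then have "2 * m + 6 - t + 1 = 2 * m + 7" by simp
      then have "(2 * m + 6 - t + 1) mod (2 * m + 7) = 0" by (simp only: mod_self)
      then show ?thesis using True by (simp add: long_label_def)
    qed
    have B: "long_label (2 * m + 6 - t) = shift (long_label ((t + 1) mod (2 * m + 7)))"
    proof (cases "t = 2 * m + 6")
      case False
      then have "(t + 1) mod (2 * m + 7) = t + 1" "2 * m + 6 - t = 2 * m + 7 - (t + 1)"
        using t by simp_all
      then show ?thesis using long_label_mirror[of "t + 1"] t False by (simp only:)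
    next
      case True
      then have "t + 1 = 2 * m + 7" by simp
      then have "(t + 1) mod (2 * m + 7) = 0" by (simp only: mod_self)
      then show ?thesis using True by (simp add: long_label_def)
    qed
    \<comment> \<open>The vertex with the translated label is the successor of
      \<open>twin v\<close>, because the direction is reversed.\<close>
    have "(2 * m + 6 - t + 1) mod (2 * m + 7) \<le> 2 * m + 6"
      using mod_less_divisor[of "2 * m + 7" "2 * m + 6 - t + 1"] by linarith
    then have "\<exists>w\<in>verts skeleton. label w = shift (label v)"
      using A Inr by (intro bexI[where x = "Inr ((2 * m + 6 - t + 1) mod (2 * m + 7))"])
        (simp_all add: Inr_in_skeleton)
    then show ?thesis using A B Inr t by (auto simp: Inr_in_skeleton)
  qed
  then show "twin v \<in> verts skeleton" "twin (twin v) = v"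
    "shift ` {label v, label (cycles_with_succ (2 * m + 7) v)} =
       {label (twin v), label (cycles_with_succ (2 * m + 7) (twin v))}"
    "\<exists>w\<in>verts skeleton. label w = shift (label v)"
    by blast+
qed

text \<open>As the image is closed under translation, it suffices to hit one of \<open>x\<close> and
  \<open>x + int n\<close> for each \<open>x\<close> from 0 to \<open>int n - 1\<close>. The two
  largest values are the points inserted at the cut; the others are labels of the graceful labeling
  or translates of them.\<close>

lemma label_surj: "starter_points n \<subseteq> label ` verts skeleton"
proof -
  let ?R = "label ` verts skeleton"
  have None: "None \<in> ?R"
    by (rule image_eqI[of _ _ "Inr 0"]) (simp_all add: long_label_def Inr_in_skeleton)
  have shift: "shift y \<in> ?R" if "y \<in> ?R" for y
  proof -
    from that obtain v where "v \<in> verts skeleton" "y = label v" by (elim imageE)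
    with twin(4)[of v] obtain w where "w \<in> verts skeleton" "label w = shift y" by blast
    then show ?thesis by (intro image_eqI[of _ _ w]) simp_all
  qed
  have both: "Some x \<in> ?R \<and> Some (x + int n) \<in> ?R"
    if "0 \<le> x" "x < int n" "Some x \<in> ?R \<or> Some (x + int n) \<in> ?R" for x
    using that shift[of "Some x"] shift[of "Some (x + int n)"] shift_mod_twice[of x] by auto
  have half: "Some (half_label t) \<in> ?R" if "1 \<le> t" "t \<le> m + 3" for t
    using that by (intro image_eqI[of _ _ "Inr t"]) (auto simp: long_label_def Inr_in_skeleton)
  have "Some x \<in> ?R \<or> Some (x + int n) \<in> ?R" if x: "0 \<le> x" "x < int n" for x
  proof -
    consider "x = int n - 1" | "x = int n - 2" | "x \<in> {0..int n - 3}" using x by force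
    then show ?thesis
    proof cases
      case 1
      then show ?thesis using half[of "k + 3"] k by (simp add: half_label_def)
    next
      case 2
      then show ?thesis using half[of "k + 2"] k by (simp add: half_label_def)
    next
      case 3
      then consider v where "v \<in> verts (cycles_graph L)" "x = F v" | "x = a" | "x = b"
        | i where "i \<le> m" "x = p i" unfolding labels[symmetric] by blast
      then show ?thesis
      proof cases
        case (1 v)
        obtain l j i where v: "v = ((l, j), i)" by (metis surj_pair)
        have "Some x \<in> ?R"
          using 1 v by (intro image_eqI[of _ _ "Inl v"]) (auto intro!: Inl_in_skeleton)
        then show ?thesis ..
      next
        case 2
        have "Some x \<in> ?R"
          using 2 by (intro image_eqI[of _ _ "Inl ((4, 2 * count L 4), 0)"]) (auto intro!: Inl_in_skeleton)
        then show ?thesis ..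
      next
        case 3
        have "Some x \<in> ?R"
          using 3 by (intro image_eqI[of _ _ "Inl ((4, 2 * count L 4), 1)"]) (auto intro!: Inl_in_skeleton)
        then show ?thesis ..
      next
        case (4 i)
        then show ?thesis using half[of "i + 1"] half[of "i + 3"] k
          by (cases "i \<le> k") (auto simp: half_label_def)
      qed
    qed
  qed
  with both have low: "Some x \<in> ?R \<and> Some (x + int n) \<in> ?R" if "0 \<le> x" "x < int n" for x
    using that by blast
  have "Some x \<in> ?R" if "0 \<le> x" "x < 2 * int n" for x
    using low[of x] low[of "x - int n"] that by (cases "x < int n") auto
  with None show ?thesis by (auto simp: starter_points_def)
qed

text \<open>Both sides have \<open>2 * n + 1\<close> elements, since the cycle lengths add up to
  \<open>4 + 2 * sum_mset L + 2 * m + 7\<close>; hence surjectivity implies injectivity.\<close>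

lemma label_bij: "bij_betw label (verts skeleton) (starter_points n)"
proof -
  have "card (label ` verts skeleton) \<le> card (starter_points n)"
    using card_image_le[OF finite_skeleton, of label] by (simp add: card_skeleton card_starter_points)
  then have eq: "starter_points n = label ` verts skeleton"
    using label_surj finite_skeleton by (intro card_seteq) auto
  moreover have "inj_on label (verts skeleton)"
    using eq by (intro eq_card_imp_inj_on finite_skeleton)
      (simp add: card_skeleton card_starter_points flip: eq)
  ultimately show ?thesis by (simp add: bij_betw_def)
qed

section \<open>The starter and its invariance under translation\<close>

definition starter :: "int option multigraph" where
  "starter = map_graph label skeleton"

lemma edges_starter:
  "edges starter = image_mset (\<lambda>v. {label v, label (cycles_with_succ (2 * m + 7) v)})
     (mset_set (verts skeleton))"
  by (simp add: starter_def map_graph_def edges_cycles_with multiset.map_comp comp_def)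

lemma verts_starter: "verts starter = starter_points n"
  using label_bij by (simp add: starter_def map_graph_def bij_betw_def)

text \<open>\<open>twin\<close> permutes the indices of the edges, so translating all edges merely
  reindexes the same multiset.\<close>

lemma translate_starter: "translate n (int n) starter = starter"
proof -
  have "bij_betw twin (verts skeleton) (verts skeleton)"
    by (rule bij_betw_byWitness[where f' = twin]) (auto simp: twin(1,2))
  then have twin_image: "image_mset twin (mset_set (verts skeleton)) = mset_set (verts skeleton)"
    by (simp add: bij_betw_def image_mset_mset_set)
  have "image_mset (image shift) (edges starter) =
      image_mset (\<lambda>v. {label (twin v), label (cycles_with_succ (2 * m + 7) (twin v))})
        (mset_set (verts skeleton))"
    unfolding edges_starter multiset.map_comp comp_def
    using twin(3) finite_skeleton by (intro image_mset_cong) (simp del: image_insert)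
  also have "\<dots> = image_mset (\<lambda>v. {label v, label (cycles_with_succ (2 * m + 7) v)})
      (image_mset twin (mset_set (verts skeleton)))"
    by (simp only: multiset.map_comp comp_def)
  also have "\<dots> = edges starter"
    unfolding twin_image edges_starter ..
  finally have "image_mset (image shift) (edges starter) = edges starter" .
  moreover have "shift ` verts starter = verts starter"
  proof
    show sub: "shift ` verts starter \<subseteq> verts starter"
      using n_pos by (auto simp: verts_starter starter_points_def)
    show "verts starter \<subseteq> shift ` verts starter"
    proof
      fix y assume y: "y \<in> verts starter"
      then have "y = shift (shift y)"
        using shift_mod_twice by (cases y) (auto simp: verts_starter starter_points_def)
      then show "y \<in> shift ` verts starter" using sub y by blast
    qed
  qed
  ultimately show ?thesis by (simp add: translate_def map_graph_def)
qed

section \<open>The differences of the starter\<close>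

lemma edge_difference:
  assumes "v \<in> verts skeleton" "label v = Some x" "label (cycles_with_succ (2 * m + 7) v) = Some y"
    and "x \<noteq> y"
  shows "(x - y) mod (2 * int n) \<in># Delta_mod n starter"
    "(y - x) mod (2 * int n) \<in># Delta_mod n starter"
proof -
  have "v \<in># mset_set (verts skeleton)"
    using assms(1) finite_skeleton by simp
  from image_eqI[OF _ this, of _ "\<lambda>v. {label v, label (cycles_with_succ (2 * m + 7) v)}", OF refl]
  have "{Some x, Some y} \<in># edges starter"
    unfolding edges_starter set_image_mset assms(2,3) .
  then show "(x - y) mod (2 * int n) \<in># Delta_mod n starter"
    "(y - x) mod (2 * int n) \<in># Delta_mod n starter"
    using assms(4) by (auto intro!: in_Delta_modI[of "{Some x, Some y}"])
qed

text \<open>The two orientations of an edge give residues that are negatives of each other, so one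
  edge settles \<open>d\<close> and \<open>2 * int n - d\<close> together, and only \<open>d\<close>
  up to \<open>int n\<close> has to be examined.\<close>

lemma edge_covers:
  assumes "v \<in> verts skeleton" "label v = Some x" "label (cycles_with_succ (2 * m + 7) v) = Some y"
    and "0 < d" "d \<le> int n" and "\<bar>x - y\<bar> = d \<or> \<bar>x - y\<bar> = 2 * int n - d"
  shows "d \<in># Delta_mod n starter" "2 * int n - d \<in># Delta_mod n starter"
proof -
  have "x \<noteq> y" using assms(4-6) n_pos by linarith
  define z where "z = \<bar>x - y\<bar>"
  have z: "0 < z" "z < 2 * int n"
    using assms(4-6) n_pos unfolding z_def by linarith+
  have "z mod (2 * int n) \<in># Delta_mod n starter \<and> (- z) mod (2 * int n) \<in># Delta_mod n starter"
    using edge_difference[OF assms(1-3) \<open>x \<noteq> y\<close>] unfolding z_def by (cases "x < y") simp_all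
  moreover have "z mod (2 * int n) = z" "(- z) mod (2 * int n) = 2 * int n - z"
    using z by (simp_all add: zmod_zminus1_eq_if)
  ultimately have "z \<in># Delta_mod n starter \<and> 2 * int n - z \<in># Delta_mod n starter"
    by simp
  moreover have "z = d \<or> z = 2 * int n - d" using assms(6) z_def by simp
  ultimately have "d \<in># Delta_mod n starter \<and> 2 * int n - d \<in># Delta_mod n starter"
    by (elim disjE) simp_all
  then show "d \<in># Delta_mod n starter" "2 * int n - d \<in># Delta_mod n starter"
    by blast+
qed

text \<open>The retained edges give 1 and 4, ..., \<open>n - 4\<close>. The 4-cycle gives 3 on the
  edge between \<open>a\<close> and \<open>b\<close>, and \<open>n - 3\<close> on the edge between
  \<open>b\<close> and \<open>a + n\<close>. At the cut the successive labels 0,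
  \<open>n - 2\<close>, \<open>2n - 1\<close>, \<open>2n - 3\<close> give \<open>n - 2\<close>, then
  \<open>n + 1\<close>, which is \<open>n - 1\<close> up to sign modulo \<open>2n\<close>, and 2.
  The middle edge of the long cycle gives \<open>n\<close>.\<close>

lemma covers:
  assumes d: "0 < d" "d \<le> int n"
  shows "d \<in># Delta_mod n starter \<and> 2 * int n - d \<in># Delta_mod n starter"
proof -
  have half: ?thesis if "1 \<le> t" "t < m + 3"
    "\<bar>half_label t - half_label (t + 1)\<bar> = d \<or> \<bar>half_label t - half_label (t + 1)\<bar> = 2 * int n - d" for t
    using edge_covers[of "Inr t", OF _ _ _ d that(3)] that(1,2)
    by (simp add: Inr_in_skeleton long_label_def)
  consider "d = 1 \<or> 4 \<le> d \<and> d < int n - 3" | "d = 2" | "d = 3" | "d = int n - 3"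
    | "d = int n - 2" | "d = int n - 1" | "d = int n" using d by linarith
  then show ?thesis
  proof cases
    case 1
    from diffs[OF 1] show ?thesis
    proof (elim disjE bexE exE conjE)
      fix v assume v: "v \<in> verts (cycles_graph L)" "\<bar>F v - F (cycle_succ v)\<bar> = d"
      obtain l j i where vv: "v = ((l, j), i)" by (metis surj_pair)
      have "v \<in> verts (cycles_graph cycle_lengths)" using v vv by auto
      from edge_covers[of "Inl v", OF Inl_in_skeleton[OF this] _ _ d] show ?thesis
        using v by (simp add: vv)
    next
      fix i assume i: "i < m" "\<bar>p i - p (Suc i)\<bar> = d"
      \<comment> \<open>The removed edge has difference \<open>int n - 3\<close>, outside the
        present range of \<open>d\<close>. Any other path edge survives on one side of the cut, and
        translating both ends keeps its difference.\<close>
      then have "i \<noteq> k" using k 1 n_pos by auto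
      then consider "i < k" | "k < i" by linarith
      then show ?thesis
      proof cases
        case 1
        then have "half_label (i + 1) = p i" "half_label (i + 1 + 1) = p (Suc i)"
          by (simp_all add: half_label_def)
        then show ?thesis using i by (intro half[of "i + 1"]) simp_all
      next
        case 2
        then have "half_label (i + 3) = p i + int n" "half_label (i + 3 + 1) = p (Suc i) + int n"
          by (simp_all add: half_label_def)
        then show ?thesis using i by (intro half[of "i + 3"]) simp_all
      qed
    qed
  next
    case 2
    then show ?thesis using half[of "k + 3"] k by (simp add: half_label_def)
  next
    case 3
    then show ?thesis
      using edge_covers[of "Inl ((4, 2 * count L 4), 0)", OF Inl_in_skeleton _ _ d] ab
      by simp
  next
    case 4
    then have "\<bar>b - (a + int n)\<bar> = d \<or> \<bar>b - (a + int n)\<bar> = 2 * int n - d"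
      using ab n_pos by linarith
    then show ?thesis
      using edge_covers[of "Inl ((4, 2 * count L 4), 1)", OF Inl_in_skeleton _ _ d]
      by simp
  next
    case 5
    then show ?thesis using half[of "k + 1"] k n_pos by (simp add: half_label_def)
  next
    case 6
    then show ?thesis using half[of "k + 2"] k n_pos by (simp add: half_label_def)
  next
    case 7
    \<comment> \<open>Positions \<open>m + 3\<close> and \<open>m + 4\<close> are where the first
      half of the long cycle meets its translate, so they carry the two translates of
      \<open>p m\<close>.\<close>
    have "long_label (4 + m) = shift (Some (half_label (m + 3)))"
      by (simp add: long_label_def add.commute)
    moreover have "half_label (m + 3) = p m + int n"
      using k by (auto simp: half_label_def)
    moreover have "(p m + int n + int n) mod (2 * int n) = p m"
      using p_range[of m] shift_mod_twice[of "p m"] n_pos by simp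
    ultimately have "long_label (4 + m) = Some (p m)" "long_label (m + 3) = Some (p m + int n)"
      by (simp_all add: long_label_def)
    moreover have "Inr (m + 3) \<in> verts skeleton" by (simp add: Inr_in_skeleton)
    ultimately show ?thesis
      using edge_covers[of "Inr (m + 3)" "p m + int n" "p m" d] d 7 by simp
  qed
qed

lemma cycle_type_starter_starter: "cycle_type_starter (2 * m + 7) cycle_lengths n starter"
  unfolding cycle_type_starter_def two_starter_def
proof (intro conjI exI)
  show "0 < n" by (simp add: n_def)
  show "two_regular starter"
    unfolding starter_def using L label_bij
    by (intro two_regular_map_graph two_regular_cycles_with)
      (auto simp: bij_betw_def dest: L)
  show "verts starter = starter_points n" by (rule verts_starter)
  show "translate n (int n) starter = starter" by (rule translate_starter)
  show "{1..<2 * int n} \<subseteq> set_mset (Delta_mod n starter)"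
  proof
    fix d assume "d \<in> {1..<2 * int n}"
    then show "d \<in># Delta_mod n starter"
      using covers[of d] covers[of "2 * int n - d"] by (cases "d \<le> int n") auto
  qed
  show "graph_iso label skeleton starter"
    using label_bij by (simp add: graph_iso_def starter_def bij_betw_def)
  show "None \<in> label ` Inr ` verts (cycle_graph (2 * m + 7))"
    by (force simp: cycle_graph_def long_label_def image_iff)
qed

end

section \<open>Reading the data off a graceful labeling\<close>

lemma edges_cycles_path_graph:
  "edges (map_graph f (cycles_path_graph K m)) =
     image_mset (\<lambda>v. {f (Inl v), f (Inl (cycle_succ v))}) (mset_set (verts (cycles_graph K))) +
     image_mset (\<lambda>i. {f (Inr i), f (Inr (Suc i))}) (mset_set {..<m})"
  by (simp add: map_graph_def cycles_path_graph_def disj_sum_def path_graph_def edges_cycles_graph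
      multiset.map_comp comp_def)

lemma in_DeltaE:
  assumes "d \<in># Delta G" and "\<And>e. e \<in># edges G \<Longrightarrow> finite e"
  obtains e x y where "e \<in># edges G" "x \<in> e" "y \<in> e" "d = x - y"
proof -
  from assms(1) obtain e where e: "e \<in># edges G"
    and d: "d \<in># image_mset (\<lambda>(x, y). x - y) (ordered_pairs e)"
    unfolding Delta_def by (auto simp: in_Union_mset_iff)
  then obtain x y where "(x, y) \<in># ordered_pairs e" "d = x - y" by auto
  then show thesis
    using that[OF e] assms(2)[OF e] by (auto simp: in_ordered_pairs)
qed

text \<open>Each of the two parallel edges contributes the absolute difference once. This is what
  forces the 2-cycle to have difference 3.\<close>

lemma count_Delta_double_edge:
  assumes "{#{a, b}, {a, b}#} \<subseteq># edges G" and "a \<noteq> b"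
  shows "2 \<le> count (Delta G) \<bar>a - b\<bar>"
proof -
  let ?D = "image_mset (\<lambda>(x, y). x - y) (ordered_pairs {a, b})"
  obtain R where "edges G = {#{a, b}, {a, b}#} + R"
    using assms(1) by (auto simp: subset_mset.le_iff_add)
  then have "count (Delta G) \<bar>a - b\<bar> \<ge> count ?D \<bar>a - b\<bar> + count ?D \<bar>a - b\<bar>"
    by (simp add: Delta_def)
  moreover have "\<bar>a - b\<bar> \<in># ?D"
  proof (cases "a < b")
    case True
    have "(b, a) \<in># ordered_pairs {a, b}" using assms(2) by (simp add: in_ordered_pairs)
    then have "(\<lambda>(x, y). x - y) (b, a) \<in># ?D" by (simp only: set_image_mset imageI)
    then show ?thesis using True by simp
  next
    case False
    have "(a, b) \<in># ordered_pairs {a, b}" using assms(2) by (simp add: in_ordered_pairs)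
    then have "(\<lambda>(x, y). x - y) (a, b) \<in># ?D" by (simp only: set_image_mset imageI)
    then show ?thesis using False by simp
  qed
  then have "1 \<le> count ?D \<bar>a - b\<bar>"
    by (simp add: Suc_le_eq)
  ultimately show ?thesis by linarith
qed

lemma verts_cycles_graph_add_2:
  assumes "2 \<notin># L"
  shows "verts (cycles_graph (add_mset 2 L)) = verts (cycles_graph L) \<union> {((2, 0), 0), ((2, 0), 1)}"
proof -
  have "count L 2 = 0" using assms by (simp add: not_in_iff)
  then show ?thesis by (auto split: if_splits)
qed

text \<open>A difference occurring twice in a graceful labeling can only be 3.\<close>

lemma graceful_starter_labels:
  assumes L: "\<forall>l\<in>#L. l > 2"
    and graceful: "graceful_labeling (add_mset 2 L) m f \<Gamma>"
    and path: "int (num_edges (add_mset 2 L) m) \<in># Delta (path_component m f)"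
  shows "\<exists>k F a b p. starter_labels L m k F a b p"
proof -
  let ?K = "add_mset 2 L"
  define n where "n = sum_mset L + m + 5"
  have eps: "int (num_edges ?K m) = int n - 3" by (simp add: num_edges_def n_def)
  have "2 \<notin># L" using L by auto
  then have count_2: "count L 2 = 0" by (simp add: not_in_iff)
  note verts_K = verts_cycles_graph_add_2[OF \<open>2 \<notin># L\<close>]
  have "count ?K 2 \<noteq> 0" by simp
  from graceful have inj: "inj_on f (verts (cycles_path_graph ?K m))"
    and \<Gamma>: "\<Gamma> = map_graph f (cycles_path_graph ?K m)"
    and verts_\<Gamma>: "verts \<Gamma> = {0..int n - 3}"
    and Delta_\<Gamma>: "Delta \<Gamma> = plus_minus {#1, 3, 3#} + plus_minus (mset_set {4..int n - 3})"
    unfolding graceful_labeling_def labeling_def graph_iso_def eps if_not_P[OF \<open>count ?K 2 \<noteq> 0\<close>]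
    by blast+
  define F where "F v = f (Inl v)" for v
  define q where "q i = f (Inr i)" for i
  define a where "a = F ((2, 0), 0)"
  define b where "b = F ((2, 0), 1)"
  have labels: "F ` verts (cycles_graph L) \<union> {a, b} \<union> q ` {..m} = {0..int n - 3}"
    unfolding verts_\<Gamma>[symmetric] \<Gamma>
    by (simp add: map_graph_def cycles_path_graph_def disj_sum_def path_graph_def verts_K Plus_def
        image_Un image_image F_def q_def a_def b_def Un_ac)
  have edges: "edges \<Gamma> = image_mset (\<lambda>v. {F v, F (cycle_succ v)}) (mset_set (verts (cycles_graph ?K))) +
      image_mset (\<lambda>i. {q i, q (Suc i)}) (mset_set {..<m})"
    unfolding \<Gamma> edges_cycles_path_graph F_def q_def ..
  have "a \<noteq> b"
    unfolding a_def b_def F_def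
    by (subst inj_on_eq_iff[OF inj]) (auto simp: cycles_path_graph_def disj_sum_def)
  \<comment> \<open>Both vertices of the 2-cycle index the same edge between \<open>a\<close> and
    \<open>b\<close>, once in each direction.\<close>
  have "{#((2, 0), 0), ((2, 0), 1)#} \<subseteq># mset_set (verts (cycles_graph ?K))"
    using subset_imp_msubset_mset_set[of "{((2, 0), 0), ((2, 0), 1)}" "verts (cycles_graph ?K)"]
    by simp
  from image_mset_subseteq_mono[OF this, of "\<lambda>v. {F v, F (cycle_succ v)}"]
  have "{#{a, b}, {a, b}#} \<subseteq># edges \<Gamma>"
    unfolding edges by (simp add: a_def b_def insert_commute subset_mset.add_increasing2)
  from count_Delta_double_edge[OF this \<open>a \<noteq> b\<close>]
  have "2 \<le> count (plus_minus {#1, 3, 3#} + plus_minus (mset_set {4..int n - 3})) \<bar>a - b\<bar>"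
    unfolding Delta_\<Gamma> .
  moreover have "count (plus_minus {#1, 3, 3#} + plus_minus (mset_set {4..int n - 3})) d < 2"
    if "0 < d" "d \<noteq> 3" for d
  proof -
    have "d \<notin> uminus ` {4..int n - 3}" using that by auto
    then have "count (image_mset uminus (mset_set {4..int n - 3})) d = 0"
      by (simp add: not_in_iff[symmetric])
    then show ?thesis
      using that by (auto simp: plus_minus_def count_mset_set')
  qed
  ultimately have ab: "\<bar>a - b\<bar> = 3"
    using \<open>a \<noteq> b\<close> by (metis linorder_not_le zero_less_abs_iff right_minus_eq)
  \<comment> \<open>The 2-cycle contributes only 3 and -3, so every admissible \<open>d\<close>
    arises on a cycle of \<open>L\<close> or on the path.\<close>
  have diffs: "(\<exists>v\<in>verts (cycles_graph L). \<bar>F v - F (cycle_succ v)\<bar> = d) \<or>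
      (\<exists>i<m. \<bar>q i - q (Suc i)\<bar> = d)" if d: "d = 1 \<or> 4 \<le> d \<and> d < int n - 3" for d
  proof -
    have "d \<in># Delta \<Gamma>" unfolding Delta_\<Gamma> using d by (auto simp: plus_minus_def)
    moreover have "finite e" if "e \<in># edges \<Gamma>" for e using that unfolding edges by auto
    ultimately obtain e x y where e: "e \<in># edges \<Gamma>" and xy: "x \<in> e" "y \<in> e" "d = x - y"
      by (rule in_DeltaE)
    have diff_e: "\<bar>u - w\<bar> = d" if "e = {u, w}" for u w using xy d that by auto
    from e consider v where "v \<in> verts (cycles_graph L)" "e = {F v, F (cycle_succ v)}"
      | "e = {a, b}" | i where "i < m" "e = {q i, q (Suc i)}"
      unfolding edges by (auto simp: verts_K a_def b_def insert_commute)
    then show ?thesis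
    proof cases
      case 1
      then show ?thesis using diff_e[OF 1(2)] by blast
    next
      case 2
      then show ?thesis using diff_e[OF 2] ab d by simp
    next
      case 3
      then show ?thesis using diff_e[OF 3(2)] by blast
    qed
  qed
  have in_range: "0 \<le> q i \<and> q i \<le> int n - 3" if "i \<le> m" for i
  proof -
    have "q i \<in> {0..int n - 3}" unfolding labels[symmetric] using that by blast
    then show ?thesis by simp
  qed
  have path_edges: "edges (path_component m f) = image_mset (\<lambda>i. {q i, q (Suc i)}) (mset_set {..<m})"
    by (simp add: path_component_def map_graph_def path_graph_def multiset.map_comp comp_def q_def)
  obtain e x y where e: "e \<in># edges (path_component m f)" "x \<in> e" "y \<in> e" "int n - 3 = x - y"
    using path unfolding eps by (rule in_DeltaE) (auto simp: path_edges)
  then obtain i where i: "i < m" "x \<in> {q i, q (Suc i)}" "y \<in> {q i, q (Suc i)}"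
    by (auto simp: path_edges)
  have "5 \<le> n" by (simp add: n_def)
  then have "int n - 3 > 0" by simp
  \<comment> \<open>Labels lie between 0 and \<open>int n - 3\<close>, so a positive difference
    \<open>int n - 3\<close> forces the two ends to be exactly these extremes; only the direction
    along the path is open.\<close>
  with i e(4) in_range[of i] in_range[of "Suc i"]
  consider "q i = 0" "q (Suc i) = int n - 3" | "q (Suc i) = 0" "q i = int n - 3"
    by force
  then show ?thesis
  proof cases
    case 1
    have "starter_labels L m i F a b q"
      using L labels i(1) 1 ab diffs unfolding n_def by unfold_locales auto
    then show ?thesis by blast
  next
    case 2
    \<comment> \<open>Here the edge is traversed from \<epsilon> to 0, so the path is reversed; its
      edge \<open>i\<close> becomes edge \<open>m - Suc i\<close>.\<close>
    have "i \<in> (\<lambda>j. m - j) ` {..m}" if "i \<le> m" for i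
      using that by (intro image_eqI[of _ _ "m - i"]) simp_all
    then have "(\<lambda>j. m - j) ` {..m} = {..m}" by auto
    moreover have "(\<lambda>j. q (m - j)) ` {..m} = q ` (\<lambda>j. m - j) ` {..m}" by (simp only: image_image)
    ultimately have rev_image: "(\<lambda>j. q (m - j)) ` {..m} = q ` {..m}" by simp
    have rev_diffs: "\<exists>j<m. \<bar>q (m - j) - q (m - Suc j)\<bar> = d" if "j < m" "\<bar>q j - q (Suc j)\<bar> = d" for j d
      using that by (intro exI[of _ "m - Suc j"]) (auto simp: Suc_diff_Suc abs_minus_commute)
    have "starter_labels L m (m - Suc i) F a b (\<lambda>j. q (m - j))"
    proof (unfold_locales, fold n_def)
      show "F ` verts (cycles_graph L) \<union> {a, b} \<union> (\<lambda>j. q (m - j)) ` {..m} = {0..int n - 3}"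
        unfolding rev_image by (rule labels)
      show "(\<exists>v\<in>verts (cycles_graph L). \<bar>F v - F (cycle_succ v)\<bar> = d) \<or>
          (\<exists>j<m. \<bar>q (m - j) - q (m - Suc j)\<bar> = d)" if "d = 1 \<or> 4 \<le> d \<and> d < int n - 3" for d
        using diffs[OF that] rev_diffs by blast
    qed (use L i(1) 2 ab in \<open>auto simp: Suc_diff_Suc\<close>)
    then show ?thesis by blast
  qed
qed

theorem theorem2p13:
  fixes L :: "nat multiset" and m :: nat
  assumes "\<forall>l\<in>#L. l > 2"
    and "\<exists>f \<Gamma>. graceful_labeling (add_mset 2 L) m f \<Gamma> \<and>
           int (num_edges (add_mset 2 L) m) \<in># Delta (path_component m f)"
  shows "\<exists>n \<Sigma>. cycle_type_starter (2 * m + 7) (add_mset 4 (L + L)) n \<Sigma>"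
proof -
  from assms obtain k F a b p where "starter_labels L m k F a b p"
    using graceful_starter_labels by blast
  from starter_labels.cycle_type_starter_starter[OF this] show ?thesis by blast
qed

end
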